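(* Let $\xi : I\to Q$ be a regular unit speed real quaternionic curve with arc-length parameter $s$, and let $\phi$ be an involute of $\xi$. If $\xi$ is a quaternionic $w$-curve, then the Serret-Frenet frame of $\phi$ is $$T_\phi(s^* )=N_\xi(s),\qquad N_\phi(s^* )=\frac{-\kappa_\xi(s)}{\sqrt{\kappa_\xi^2(s)+k^2(s)}}\,T_\xi(s)+\frac{k(s)}{\sqrt{\kappa_\xi^2(s)+k^2(s)}}\,B_\xi(s),$$ $$B_\phi(s^* )=\eta\,E_\xi(s),\qquad E_\phi(s^* )=\eta\left[\frac{k(s)}{\sqrt{\kappa_\xi^2(s)+k^2(s)}}\,T_\xi(s)+\frac{\kappa_\xi(s)}{\sqrt{\kappa_\xi^2(s)+k^2(s)}}\,B_\xi(s)\right],$$ where $\eta=\pm1$.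
   Context: $Q$ is the algebra of real quaternions, identified with Euclidean space $\mathbb{R}^4$; $I\subset\mathbb{R}$ is an interval; $\times$ is the quaternion product, $\hat q$ the conjugate, and $h(p,q)=\frac12(p\times\hat q+q\times\hat p)$ the quaternion inner product (equal to the Euclidean inner product of $\mathbb{R}^4$). A real quaternionic curve is a smooth curve $I\to Q$. The Serret-Frenet apparatus of a quaternionic curve $\xi$ with arc-length parameter $s$ consists of an orthonormal frame $\{T_\xi,N_\xi,B_\xi,E_\xi\}$ with $T_\xi=\xi'$ and curvatures $\kappa_\xi=\|T_\xi'\|$, $k$, $r-\kappa_\xi$ satisfying $$T_\xi'=\kappa_\xi N_\xi,\quad N_\xi'=-\kappa_\xi T_\xi+kB_\xi,\quad B_\xi'=-kN_\xi+(r-\kappa_\xi)E_\xi,\quad E_\xi'=-(r-\kappa_\xi)B_\xi .$$ The frame $\{T_\phi,N_\phi,B_\phi,E_\phi\}$ and curvatures $\kappa_\phi,k^*,r^*-\kappa_\phi$ of $\phi$ are defined in the same way with respect to its arc-length parameter $s^*$; the last frame vector is determined only up to a sign $\eta=\pm1$ fixing the orientation. The curves are assumed nondegenerate so that these frames are defined. A $w$-curve is a curve all of whose curvatures are constant. Curves $\phi$ and $\xi$ with parameters $s^*$ and $s$, whose points are in a correspondence $s\leftrightarrow s^*$, are quaternionic involute-evolute curves ($\phi$ an involute of $\xi$) if $h(T_\phi(s^* ),T_\xi(s))=0$ at corresponding points and $\phi(s^* )$ lies on the tangent line of $\xi$ at $\xi(s)$; then $\phi(s^* )=\xi(s)+(c-s)T_\xi(s)$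 for a constant $c$. Sign convention: $s^*$ increases with $s$, and of the two possibilities $T_\phi=\pm N_\xi$ the one with the plus sign is taken (this is the part of the involute where $c-s>0$). *)

theory Defs
  imports "HOL-Analysis.Analysis"
begin

section \<open>Quaternions\<close>

text \<open>The quaternion \<open>a + bi + cj + dk\<close> is the vector \<open>(a, b, c, d)\<close>.\<close>

type_synonym quat = "real ^ 4"

definition qmult :: "quat \<Rightarrow> quat \<Rightarrow> quat" (infixl "\<otimes>\<^sub>q" 70) where
  "p \<otimes>\<^sub>q q = vector
     [p$1 * q$1 - p$2 * q$2 - p$3 * q$3 - p$4 * q$4,
      p$1 * q$2 + p$2 * q$1 + p$3 * q$4 - p$4 * q$3,
      p$1 * q$3 - p$2 * q$4 + p$3 * q$1 + p$4 * q$2,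
      p$1 * q$4 + p$2 * q$3 - p$3 * q$2 + p$4 * q$1]"

definition qconj :: "quat \<Rightarrow> quat" where
  "qconj p = vector [p$1, - (p$2), - (p$3), - (p$4)]"

text \<open>The bracketed quaternion has vanishing imaginary part (lemma \<open>qinner_real\<close>), so the
  first component is only the identification of real quaternions with real numbers.\<close>

definition qinner :: "quat \<Rightarrow> quat \<Rightarrow> real" where
  "qinner p q = ((1/2) *\<^sub>R (p \<otimes>\<^sub>q qconj q + q \<otimes>\<^sub>q qconj p)) $ 1"

lemma vector_4:
  "(vector [w,x,y,z] :: ('a::zero)^4) $ 1 = w"
  "(vector [w,x,y,z] :: ('a::zero)^4) $ 2 = x"
  "(vector [w,x,y,z] :: ('a::zero)^4) $ 3 = y"
  "(vector [w,x,y,z] :: ('a::zero)^4) $ 4 = z"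
  unfolding vector_def by simp_all

lemma qinner_real:
  "(1/2) *\<^sub>R (p \<otimes>\<^sub>q qconj q + q \<otimes>\<^sub>q qconj p) = vector [qinner p q, 0, 0, 0]"
  by (simp add: vec_eq_iff forall_4 vector_4 qinner_def qmult_def qconj_def field_simps)

lemma qinner_eq_inner: "qinner p q = p \<bullet> q"
  by (simp add: qinner_def qmult_def qconj_def vector_4 inner_vec_def sum_4 algebra_simps)


section \<open>Curves and their Serret-Frenet apparatus\<close>

text \<open>Smoothness: \<open>D n\<close> is the \<open>n\<close>-th derivative. The interval may contain end points, where
  derivatives are one-sided; it must not be degenerate.\<close>

definition quaternionic_curve :: "real set \<Rightarrow> (real \<Rightarrow> quat) \<Rightarrow> bool" where
  "quaternionic_curve I \<alpha> \<longleftrightarrow>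
     is_interval I \<and> interior I \<noteq> {} \<and>
     (\<exists>D :: nat \<Rightarrow> real \<Rightarrow> quat.
        (\<forall>s\<in>I. D 0 s = \<alpha> s) \<and>
        (\<forall>n. \<forall>s\<in>I. (D n has_vector_derivative D (Suc n) s) (at s within I)))"

definition q_orthonormal :: "quat \<Rightarrow> quat \<Rightarrow> quat \<Rightarrow> quat \<Rightarrow> bool" where
  "q_orthonormal a b c d \<longleftrightarrow>
     qinner a a = 1 \<and> qinner b b = 1 \<and> qinner c c = 1 \<and> qinner d d = 1 \<and>
     qinner a b = 0 \<and> qinner a c = 0 \<and> qinner a d = 0 \<and>
     qinner b c = 0 \<and> qinner b d = 0 \<and> qinner c d = 0"

text \<open>The curvatures are \<open>\<kappa>\<close>, \<open>k\<close> and \<open>r - \<kappa>\<close>. As \<open>T = \<alpha>'\<close> is a unit vector, \<open>\<alpha>\<close> is parametrised by arc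
  length. Nondegeneracy is \<open>\<kappa> \<noteq> 0\<close> and \<open>k \<noteq> 0\<close>. No sign is prescribed for \<open>k\<close> and no orientation
  for the frame, so replacing \<open>B\<close> by \<open>- B\<close> or \<open>E\<close> by \<open>- E\<close>, with the corresponding sign changes
  of \<open>k\<close> and \<open>r - \<kappa>\<close>, gives an apparatus of the same curve.\<close>

definition serret_frenet ::
  "real set \<Rightarrow> (real \<Rightarrow> quat) \<Rightarrow>
   (real \<Rightarrow> quat) \<Rightarrow> (real \<Rightarrow> quat) \<Rightarrow> (real \<Rightarrow> quat) \<Rightarrow> (real \<Rightarrow> quat) \<Rightarrow>
   (real \<Rightarrow> real) \<Rightarrow> (real \<Rightarrow> real) \<Rightarrow> (real \<Rightarrow> real) \<Rightarrow> bool" where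
  "serret_frenet I \<alpha> T N B E \<kappa> k r \<longleftrightarrow>
     (\<forall>s\<in>I.
        q_orthonormal (T s) (N s) (B s) (E s) \<and>
        \<kappa> s = norm (vector_derivative T (at s within I)) \<and> \<kappa> s \<noteq> 0 \<and> k s \<noteq> 0 \<and>
        (\<alpha> has_vector_derivative T s) (at s within I) \<and>
        (T has_vector_derivative \<kappa> s *\<^sub>R N s) (at s within I) \<and>
        (N has_vector_derivative - \<kappa> s *\<^sub>R T s + k s *\<^sub>R B s) (at s within I) \<and>
        (B has_vector_derivative - k s *\<^sub>R N s + (r s - \<kappa> s) *\<^sub>R E s) (at s within I) \<and>
        (E has_vector_derivative - (r s - \<kappa> s) *\<^sub>R B s) (at s within I))"

definition serret_frenet_frame ::
  "real set \<Rightarrow> (real \<Rightarrow> quat) \<Rightarrow>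
   (real \<Rightarrow> quat) \<Rightarrow> (real \<Rightarrow> quat) \<Rightarrow> (real \<Rightarrow> quat) \<Rightarrow> (real \<Rightarrow> quat) \<Rightarrow> bool" where
  "serret_frenet_frame I \<alpha> T N B E \<longleftrightarrow> (\<exists>\<kappa> k r. serret_frenet I \<alpha> T N B E \<kappa> k r)"

definition w_curve ::
  "real set \<Rightarrow> (real \<Rightarrow> real) \<Rightarrow> (real \<Rightarrow> real) \<Rightarrow> (real \<Rightarrow> real) \<Rightarrow> bool" where
  "w_curve I \<kappa> k r \<longleftrightarrow>
     \<kappa> constant_on I \<and> k constant_on I \<and> (\<lambda>s. r s - \<kappa> s) constant_on I"


section \<open>Involutes\<close>

text \<open>The correspondence is \<open>s* = \<sigma> s\<close>; it is a bijection that increases with \<open>s\<close>, and it is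
  differentiable, so that one may pass between derivatives in \<open>s\<close> and in \<open>s*\<close>.\<close>

definition correspondence :: "real set \<Rightarrow> real set \<Rightarrow> (real \<Rightarrow> real) \<Rightarrow> bool" where
  "correspondence I J \<sigma> \<longleftrightarrow>
     bij_betw \<sigma> I J \<and> strict_mono_on I \<sigma> \<and> \<sigma> differentiable_on I"

definition involute ::
  "real set \<Rightarrow> (real \<Rightarrow> real) \<Rightarrow>
   (real \<Rightarrow> quat) \<Rightarrow> (real \<Rightarrow> quat) \<Rightarrow> (real \<Rightarrow> quat) \<Rightarrow> (real \<Rightarrow> quat) \<Rightarrow> bool" where
  "involute I \<sigma> \<xi> T\<^sub>\<xi> \<phi> T\<^sub>\<phi> \<longleftrightarrow>
     (\<forall>s\<in>I. qinner (T\<^sub>\<phi> (\<sigma> s)) (T\<^sub>\<xi> s) = 0 \<and> \<phi> (\<sigma> s) \<in> {\<xi> s + t *\<^sub>R T\<^sub>\<xi> s | t. True})"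

text \<open>For an involute \<open>\<phi> (\<sigma> s) = \<xi> s + (c - s) *\<^sub>R T\<^sub>\<xi> s\<close>, the left-hand side below is \<open>c - s\<close>.\<close>

definition involute_forward ::
  "real set \<Rightarrow> (real \<Rightarrow> real) \<Rightarrow> (real \<Rightarrow> quat) \<Rightarrow> (real \<Rightarrow> quat) \<Rightarrow> (real \<Rightarrow> quat) \<Rightarrow> bool" where
  "involute_forward I \<sigma> \<xi> T\<^sub>\<xi> \<phi> \<longleftrightarrow> (\<forall>s\<in>I. qinner (\<phi> (\<sigma> s) - \<xi> s) (T\<^sub>\<xi> s) > 0)"

end

theory Submission
  imports Defs
begin

text \<open>
  Write \<open>\<phi> (\<sigma> s) = \<xi> s + u s *\<^sub>R T s\<close> with \<open>u > 0\<close>. Differentiating and using \<open>T\<^sub>\<phi> \<bottom> T\<close> gives \<open>u' = -1\<close>,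
  hence \<open>\<sigma>' T\<^sub>\<phi> = u \<kappa> N\<close> and so \<open>\<sigma>' = u \<kappa> > 0\<close>, \<open>T\<^sub>\<phi> = N\<close>. Differentiating this gives \<open>N\<^sub>\<phi>\<close>, and
  differentiating once more, now with constant curvatures, shows that \<open>B\<^sub>\<phi>\<close> is a multiple of \<open>E\<close>,
  with a continuous sign that is constant on the interval. The vector \<open>E\<^sub>\<phi>\<close> is orthogonal to the
  three others, which determines it up to a sign that is constant for the same reason.
\<close>

section \<open>Limits, derivatives and signs on an interval\<close>

text \<open>A connected set with more than one point has no isolated points, so derivatives within
  it are unique, even at end points.\<close>

lemma at_within_interval_neq_bot:
  fixes I :: "real set"
  assumes "is_interval I" "interior I \<noteq> {}" "s \<in> I"
  shows "at s within I \<noteq> bot"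
proof -
  have "I \<noteq> {x}" for x
    using assms(2) by auto
  with assms have "s islimpt I"
    by (intro connected_imp_perfect) (auto simp: is_interval_connected)
  then show ?thesis
    by (simp add: trivial_limit_within)
qed

text \<open>Difference quotients of a monotone function are nonnegative on both sides of
  \<open>x\<close>, and this passes to the limit.\<close>

lemma has_real_derivative_nonneg_if_mono_on:
  fixes f :: "real \<Rightarrow> real"
  assumes "mono_on S f" "(f has_real_derivative D) (at x within S)" "x \<in> S"
    and "at x within S \<noteq> bot"
  shows "D \<ge> 0"
proof (rule tendsto_lowerbound)
  show "((\<lambda>y. (f y - f x) / (y - x)) \<longlongrightarrow> D) (at x within S)"
    using assms(2) by (simp add: has_field_derivative_iff)
  have "0 \<le> (f y - f x) / (y - x)" if "y \<in> S" for y
  proof (cases "y \<ge> x")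
    case True
    then show ?thesis
      using mono_onD[OF assms(1) assms(3) that] by simp
  next
    case False
    then show ?thesis
      using mono_onD[OF assms(1) that assms(3)] by (simp add: divide_nonpos_nonpos)
  qed
  then show "\<forall>\<^sub>F y in at x within S. 0 \<le> (f y - f x) / (y - x)"
    by (simp add: eventually_at_filter)
qed (use assms in auto)

text \<open>A continuous function with finite range is constant on a connected set. This turns signs
  found point by point into one sign for the whole interval.\<close>

lemma sign_function_constant:
  fixes f :: "real \<Rightarrow> real"
  assumes "is_interval I" "continuous_on I f" "\<And>s. s \<in> I \<Longrightarrow> f s \<in> {1, -1}"
  obtains e where "e \<in> {1, -1}" "\<And>s. s \<in> I \<Longrightarrow> f s = e"
proof -
  have "finite (f ` I)"
    using assms(3) by (intro finite_subset[of "f ` I" "{1, -1}"]) auto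
  then have "f constant_on I"
    using continuous_finite_range_constant[OF _ assms(2)] assms(1)
    by (auto simp: is_interval_connected)
  then obtain c where c: "\<And>s. s \<in> I \<Longrightarrow> f s = c"
    by (auto simp: constant_on_def)
  show ?thesis
  \<comment> \<open>On the empty set nothing is known about \<open>c\<close>, so the sign 1 serves
    as a default.\<close>
  proof (cases "I = {}")
    case True
    then show ?thesis using that[of 1] by auto
  next
    case False
    then show ?thesis using that[of c] c assms(3) by force
  qed
qed

section \<open>Unit vectors and orthonormal frames\<close>

text \<open>Taking norms compares the coefficients. Only \<open>c \<ge> 0\<close> is asked, so that
  positivity of a speed can come out of the equation.\<close>

lemma scaleR_unit_eqD:
  fixes x y :: "'a::real_normed_vector"
  assumes "c *\<^sub>R x = d *\<^sub>R y" "norm x = 1" "norm y = 1" "c \<ge> 0" "d > 0"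
  shows "c = d" "x = y"
proof -
  have "norm (c *\<^sub>R x) = norm (d *\<^sub>R y)"
    using assms(1) by simp
  then show "c = d"
    using assms(2-5) by simp
  then show "x = y"
    using assms by simp
qed

text \<open>Norms determine \<open>d / c\<close> up to sign. The sign is written as
  \<open>x \<bullet> y\<close> so that it depends continuously on the vectors.\<close>

lemma scaleR_unit_eq_signD:
  fixes x y :: "'a::real_inner"
  assumes "c *\<^sub>R x = d *\<^sub>R y" "norm x = 1" "norm y = 1" "c \<noteq> 0"
  shows "x \<bullet> y \<in> {1, -1}" "x = (x \<bullet> y) *\<^sub>R y"
proof -
  have x: "x = (d / c) *\<^sub>R y"
    using assms(1,4) by (metis divide_inverse_commute scaleR_one scaleR_scaleR left_inverse)
  have "y \<bullet> y = 1"
    using assms(3) by (simp add: norm_eq_1)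
  then have xy: "x \<bullet> y = d / c"
    by (subst x) simp
  then show "x = (x \<bullet> y) *\<^sub>R y"
    using x by simp
  have "\<bar>d / c\<bar> = 1"
    using assms(2,3) x by (metis norm_scaleR mult.right_neutral)
  then show "x \<bullet> y \<in> {1, -1}"
    unfolding xy by (auto simp: abs_if split: if_splits)
qed

text \<open>Four orthonormal vectors span the whole space, so \<open>v\<close> lies in their span
  and is orthogonal to itself.\<close>

lemma q_orthonormal_eq_0:
  assumes "q_orthonormal a b c d"
    and "v \<bullet> a = 0" "v \<bullet> b = 0" "v \<bullet> c = 0" "v \<bullet> d = 0"
  shows "v = 0"
proof -
  let ?S = "{a, b, c, d}"
  have ip: "a \<bullet> a = 1" "b \<bullet> b = 1" "c \<bullet> c = 1" "d \<bullet> d = 1"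
    "a \<bullet> b = 0" "a \<bullet> c = 0" "a \<bullet> d = 0" "b \<bullet> c = 0" "b \<bullet> d = 0" "c \<bullet> d = 0"
    using assms(1) by (auto simp: q_orthonormal_def qinner_eq_inner)
  then have "distinct [a, b, c, d]"
    by auto
  then have card: "card ?S = 4"
    by simp
  have "pairwise orthogonal ?S"
    using ip by (auto simp: pairwise_def orthogonal_def inner_commute)
  moreover have "0 \<notin> ?S"
    using ip by auto
  ultimately have "independent ?S"
    by (rule pairwise_orthogonal_independent)
  then have "span ?S = UNIV"
    using card by (intro dim_eq_full[THEN iffD1]) (simp add: dim_eq_card_independent)
  then have "v \<in> span ?S"
    by simp
  then have "orthogonal v v"
    by (rule orthogonal_to_span) (use assms in \<open>auto simp: orthogonal_def\<close>)
  then show ?thesis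
    by (simp add: orthogonal_self)
qed

text \<open>The difference of \<open>e\<close> and its projection onto \<open>d\<close> is
  orthogonal to all four vectors of the first frame.\<close>

lemma q_orthonormal_4th_unique:
  assumes "q_orthonormal a b c d" "q_orthonormal a b c e"
  shows "e \<bullet> d \<in> {1, -1}" "e = (e \<bullet> d) *\<^sub>R d"
proof -
  have "e - (e \<bullet> d) *\<^sub>R d = 0"
    using assms by (intro q_orthonormal_eq_0[OF assms(1)])
      (auto simp: q_orthonormal_def qinner_eq_inner inner_diff_left inner_diff_right inner_commute)
  then have *: "1 *\<^sub>R e = (e \<bullet> d) *\<^sub>R d"
    by simp
  moreover have "norm e = 1" "norm d = 1"
    using assms by (auto simp: q_orthonormal_def qinner_eq_inner norm_eq_1)
  ultimately show "e \<bullet> d \<in> {1, -1}" "e = (e \<bullet> d) *\<^sub>R d"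
    using scaleR_unit_eq_signD[OF *] by auto
qed

lemma q_orthonormal_scaleR_sign:
  assumes "q_orthonormal a b c d" "x \<in> {1, -1}" "y \<in> {1, -1}"
  shows "q_orthonormal a b (x *\<^sub>R c) (y *\<^sub>R d)"
  using assms by (auto simp: q_orthonormal_def qinner_eq_inner)

text \<open>As \<open>x\<close> and \<open>y\<close> square to 1, the third curvature is multiplied
  by \<open>x * y\<close>; the last argument is chosen so that subtracting \<open>\<kappa> s\<close>
  leaves this product. The lemma provides the frames for both signs in the theorem.\<close>

lemma serret_frenet_scaleR_sign:
  assumes "serret_frenet I \<alpha> T N B E \<kappa> k r" "x \<in> {1, -1}" "y \<in> {1, -1}"
  shows "serret_frenet I \<alpha> T N (\<lambda>s. x *\<^sub>R B s) (\<lambda>s. y *\<^sub>R E s)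
           \<kappa> (\<lambda>s. x * k s) (\<lambda>s. \<kappa> s + x * y * (r s - \<kappa> s))"
  unfolding serret_frenet_def
proof (intro ballI conjI)
  fix s assume s: "s \<in> I"
  note sf = assms(1)[unfolded serret_frenet_def, rule_format, OF s]
  show "q_orthonormal (T s) (N s) (x *\<^sub>R B s) (y *\<^sub>R E s)"
    using q_orthonormal_scaleR_sign sf assms(2,3) by blast
  show "x * k s \<noteq> 0"
    using sf assms(2) by auto
  show "(N has_vector_derivative - \<kappa> s *\<^sub>R T s + (x * k s) *\<^sub>R x *\<^sub>R B s) (at s within I)"
    using sf assms(2) by auto
  have "((\<lambda>s. x *\<^sub>R B s) has_vector_derivative
      x *\<^sub>R (- k s *\<^sub>R N s + (r s - \<kappa> s) *\<^sub>R E s)) (at s within I)"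
    using sf by (intro has_vector_derivative_scaleR[of "\<lambda>_. x" 0, simplified]) auto
  then show "((\<lambda>s. x *\<^sub>R B s) has_vector_derivative
      - (x * k s) *\<^sub>R N s + (\<kappa> s + x * y * (r s - \<kappa> s) - \<kappa> s) *\<^sub>R y *\<^sub>R E s) (at s within I)"
    using assms(3) by (auto simp: scaleR_add_right algebra_simps)
  have "((\<lambda>s. y *\<^sub>R E s) has_vector_derivative y *\<^sub>R (- (r s - \<kappa> s) *\<^sub>R B s)) (at s within I)"
    using sf by (intro has_vector_derivative_scaleR[of "\<lambda>_. y" 0, simplified]) auto
  then show "((\<lambda>s. y *\<^sub>R E s) has_vector_derivative
      - (\<kappa> s + x * y * (r s - \<kappa> s) - \<kappa> s) *\<^sub>R x *\<^sub>R B s) (at s within I)"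
    using assms(2) by (auto simp: algebra_simps)
qed (use assms(1) in \<open>auto simp: serret_frenet_def\<close>)

section \<open>An involute of a curve with constant curvatures\<close>

locale involute_w_curve =
  fixes I J :: "real set" and \<xi> \<phi> :: "real \<Rightarrow> quat" and \<sigma> :: "real \<Rightarrow> real"
    and T N B E T\<^sub>\<phi> N\<^sub>\<phi> B\<^sub>\<phi> E\<^sub>\<phi> :: "real \<Rightarrow> quat"
    and \<kappa>\<^sub>\<xi> k\<^sub>\<xi> r\<^sub>\<xi> \<kappa>\<^sub>\<phi> k\<^sub>\<phi> r\<^sub>\<phi> :: "real \<Rightarrow> real" and \<kappa> k m :: real
  assumes interval: "is_interval I" "interior I \<noteq> {}"
    and frame: "serret_frenet I \<xi> T N B E \<kappa>\<^sub>\<xi> k\<^sub>\<xi> r\<^sub>\<xi>"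
    and curvatures: "s \<in> I \<Longrightarrow> \<kappa>\<^sub>\<xi> s = \<kappa>" "s \<in> I \<Longrightarrow> k\<^sub>\<xi> s = k" "s \<in> I \<Longrightarrow> r\<^sub>\<xi> s - \<kappa>\<^sub>\<xi> s = m"
    and frame': "serret_frenet J \<phi> T\<^sub>\<phi> N\<^sub>\<phi> B\<^sub>\<phi> E\<^sub>\<phi> \<kappa>\<^sub>\<phi> k\<^sub>\<phi> r\<^sub>\<phi>"
    and corr: "correspondence I J \<sigma>"
    and inv: "involute I \<sigma> \<xi> T \<phi> T\<^sub>\<phi>"
    and forward: "involute_forward I \<sigma> \<xi> T \<phi>"
begin

text \<open>The length of the derivative of \<open>N\<close> on \<open>I\<close>.\<close>

definition w :: real where "w = sqrt (\<kappa>\<^sup>2 + k\<^sup>2)"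

lemma image_eq: "\<sigma> ` I = J"
  using corr by (simp add: correspondence_def bij_betw_def)

lemma frame_facts:
  assumes "s \<in> I"
  shows "\<kappa> > 0" "k \<noteq> 0" "q_orthonormal (T s) (N s) (B s) (E s)"
    "(\<xi> has_vector_derivative T s) (at s within I)"
    "(T has_vector_derivative \<kappa> *\<^sub>R N s) (at s within I)"
    "(N has_vector_derivative - \<kappa> *\<^sub>R T s + k *\<^sub>R B s) (at s within I)"
    "(B has_vector_derivative - k *\<^sub>R N s + m *\<^sub>R E s) (at s within I)"
    "(E has_vector_derivative - m *\<^sub>R B s) (at s within I)"
proof -
  \<comment> \<open>The difference becomes \<open>m\<close> first; it would lose its shape once
    \<open>\<kappa>\<^sub>\<xi> s\<close> is rewritten.\<close>
  note f = frame[unfolded serret_frenet_def, rule_format, OF assms,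
      unfolded curvatures(3)[OF assms], unfolded curvatures(1,2)[OF assms]]
  have "\<kappa> = norm (vector_derivative T (at s within I))" "\<kappa> \<noteq> 0"
    using f by blast+
  then show "\<kappa> > 0"
    by simp
qed (use frame[unfolded serret_frenet_def, rule_format, OF assms,
      unfolded curvatures(3)[OF assms], unfolded curvatures(1,2)[OF assms]]
      in blast)+

lemma inner_facts:
  assumes "s \<in> I"
  shows "norm (T s) = 1" "norm (N s) = 1" "norm (B s) = 1" "norm (E s) = 1"
    "T s \<bullet> T s = 1" "N s \<bullet> N s = 1" "B s \<bullet> B s = 1" "E s \<bullet> E s = 1"
    "T s \<bullet> N s = 0" "T s \<bullet> B s = 0" "T s \<bullet> E s = 0" "N s \<bullet> B s = 0" "N s \<bullet> E s = 0" "B s \<bullet> E s = 0"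
    "N s \<bullet> T s = 0" "B s \<bullet> T s = 0" "E s \<bullet> T s = 0" "B s \<bullet> N s = 0" "E s \<bullet> N s = 0" "E s \<bullet> B s = 0"
  using frame_facts(3)[OF assms]
  by (simp_all add: q_orthonormal_def qinner_eq_inner norm_eq_1 inner_commute)

lemma frame_facts':
  assumes "s \<in> I"
  shows "\<kappa>\<^sub>\<phi> (\<sigma> s) > 0" "k\<^sub>\<phi> (\<sigma> s) \<noteq> 0"
    "q_orthonormal (T\<^sub>\<phi> (\<sigma> s)) (N\<^sub>\<phi> (\<sigma> s)) (B\<^sub>\<phi> (\<sigma> s)) (E\<^sub>\<phi> (\<sigma> s))"
    "norm (T\<^sub>\<phi> (\<sigma> s)) = 1" "norm (N\<^sub>\<phi> (\<sigma> s)) = 1" "norm (B\<^sub>\<phi> (\<sigma> s)) = 1"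
proof -
  have "\<sigma> s \<in> J"
    using assms image_eq by blast
  note f = frame'[unfolded serret_frenet_def, rule_format, OF this]
  have "\<kappa>\<^sub>\<phi> (\<sigma> s) = norm (vector_derivative T\<^sub>\<phi> (at (\<sigma> s) within J))" "\<kappa>\<^sub>\<phi> (\<sigma> s) \<noteq> 0"
    using f by blast+
  then show "\<kappa>\<^sub>\<phi> (\<sigma> s) > 0"
    by simp
  show "k\<^sub>\<phi> (\<sigma> s) \<noteq> 0"
    "q_orthonormal (T\<^sub>\<phi> (\<sigma> s)) (N\<^sub>\<phi> (\<sigma> s)) (B\<^sub>\<phi> (\<sigma> s)) (E\<^sub>\<phi> (\<sigma> s))"
    using f by blast+
  then show "norm (T\<^sub>\<phi> (\<sigma> s)) = 1" "norm (N\<^sub>\<phi> (\<sigma> s)) = 1" "norm (B\<^sub>\<phi> (\<sigma> s)) = 1"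
    by (auto simp: q_orthonormal_def qinner_eq_inner norm_eq_1)
qed

section \<open>Differentiation along the correspondence\<close>

definition speed :: "real \<Rightarrow> real" where
  "speed s = vector_derivative \<sigma> (at s within I)"

lemma has_vector_derivative_\<sigma>:
  assumes "s \<in> I"
  shows "(\<sigma> has_vector_derivative speed s) (at s within I)"
  unfolding speed_def using corr assms
  by (auto simp: correspondence_def differentiable_on_def vector_derivative_works)

lemma has_vector_derivative_comp_\<sigma>:
  assumes "s \<in> I" "(f has_vector_derivative D) (at (\<sigma> s) within J)"
  shows "((\<lambda>s. f (\<sigma> s)) has_vector_derivative speed s *\<^sub>R D) (at s within I)"
  using vector_diff_chain_within[OF has_vector_derivative_\<sigma>[OF assms(1)], of f D] assms(2)
  by (simp add: image_eq comp_def)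

lemma frame_derivatives':
  assumes "s \<in> I"
  shows "((\<lambda>s. \<phi> (\<sigma> s)) has_vector_derivative speed s *\<^sub>R T\<^sub>\<phi> (\<sigma> s)) (at s within I)"
    "((\<lambda>s. T\<^sub>\<phi> (\<sigma> s)) has_vector_derivative (speed s * \<kappa>\<^sub>\<phi> (\<sigma> s)) *\<^sub>R N\<^sub>\<phi> (\<sigma> s)) (at s within I)"
    "((\<lambda>s. N\<^sub>\<phi> (\<sigma> s)) has_vector_derivative
       speed s *\<^sub>R (- \<kappa>\<^sub>\<phi> (\<sigma> s) *\<^sub>R T\<^sub>\<phi> (\<sigma> s) + k\<^sub>\<phi> (\<sigma> s) *\<^sub>R B\<^sub>\<phi> (\<sigma> s))) (at s within I)"
    "((\<lambda>s. B\<^sub>\<phi> (\<sigma> s)) has_vector_derivative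
       speed s *\<^sub>R (- k\<^sub>\<phi> (\<sigma> s) *\<^sub>R N\<^sub>\<phi> (\<sigma> s) + (r\<^sub>\<phi> (\<sigma> s) - \<kappa>\<^sub>\<phi> (\<sigma> s)) *\<^sub>R E\<^sub>\<phi> (\<sigma> s))) (at s within I)"
    "((\<lambda>s. E\<^sub>\<phi> (\<sigma> s)) has_vector_derivative
       speed s *\<^sub>R (- (r\<^sub>\<phi> (\<sigma> s) - \<kappa>\<^sub>\<phi> (\<sigma> s)) *\<^sub>R B\<^sub>\<phi> (\<sigma> s))) (at s within I)"
proof -
  have "\<sigma> s \<in> J"
    using assms image_eq by blast
  then have "(T\<^sub>\<phi> has_vector_derivative \<kappa>\<^sub>\<phi> (\<sigma> s) *\<^sub>R N\<^sub>\<phi> (\<sigma> s)) (at (\<sigma> s) within J)"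
    using frame' unfolding serret_frenet_def by blast
  from has_vector_derivative_comp_\<sigma>[OF assms this]
  show "((\<lambda>s. T\<^sub>\<phi> (\<sigma> s)) has_vector_derivative (speed s * \<kappa>\<^sub>\<phi> (\<sigma> s)) *\<^sub>R N\<^sub>\<phi> (\<sigma> s)) (at s within I)"
    by simp
qed (intro has_vector_derivative_comp_\<sigma>[OF assms],
     use frame'[unfolded serret_frenet_def, rule_format, of "\<sigma> s"] image_eq assms in blast)+

text \<open>Points of \<open>I\<close> are not isolated in \<open>I\<close>. The tangent, the normal
  and the binormal are all found by differentiating two expressions for one curve and comparing the
  results.\<close>

lemma derivative_unique:
  assumes "s \<in> I" "(f has_vector_derivative a) (at s within I)"
    and "(g has_vector_derivative b) (at s within I)" "\<And>t. t \<in> I \<Longrightarrow> f t = g t"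
  shows "a = b"
proof (rule vector_derivative_unique_within)
  show "at s within I \<noteq> bot"
    using at_within_interval_neq_bot interval assms(1) by blast
  show "(g has_vector_derivative a) (at s within I)"
    by (rule has_vector_derivative_transform[OF assms(1) _ assms(2)]) (simp add: assms(4))
qed (rule assms)

text \<open>Even strict monotonicity allows a zero derivative at a point; strict positivity is
  obtained in \<open>tangent\<close>.\<close>

lemma speed_nonneg:
  assumes "s \<in> I"
  shows "speed s \<ge> 0"
proof (rule has_real_derivative_nonneg_if_mono_on[OF _ _ assms])
  show "mono_on I \<sigma>"
    using corr by (simp add: correspondence_def strict_mono_on_imp_mono_on)
  show "(\<sigma> has_real_derivative speed s) (at s within I)"
    using has_vector_derivative_\<sigma>[OF assms]
    by (simp add: has_real_derivative_iff_has_vector_derivative)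
  show "at s within I \<noteq> bot"
    using at_within_interval_neq_bot interval assms by blast
qed

section \<open>The frame vectors of the involute\<close>

lemma tangent:
  assumes s: "s \<in> I"
  shows "speed s > 0" "T\<^sub>\<phi> (\<sigma> s) = N s"
proof -
  \<comment> \<open>This is the coordinate on the tangent line. As an inner product it is
    differentiable by the product rule.\<close>
  define u where "u s = (\<phi> (\<sigma> s) - \<xi> s) \<bullet> T s" for s
  have u_pos: "u s > 0"
    using forward s by (simp add: involute_forward_def qinner_eq_inner u_def)
  have \<phi>: "\<phi> (\<sigma> t) = \<xi> t + u t *\<^sub>R T t" if t: "t \<in> I" for t
  proof -
    obtain c where "\<phi> (\<sigma> t) = \<xi> t + c *\<^sub>R T t"
      using inv t by (auto simp: involute_def)
    then show ?thesis
      using inner_facts[OF t] by (simp add: u_def)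
  qed
  have orth: "T\<^sub>\<phi> (\<sigma> s) \<bullet> T s = 0"
    using inv s by (auto simp: involute_def qinner_eq_inner)
  have "(u has_vector_derivative
      (\<phi> (\<sigma> s) - \<xi> s) \<bullet> (\<kappa> *\<^sub>R N s) + (speed s *\<^sub>R T\<^sub>\<phi> (\<sigma> s) - T s) \<bullet> T s) (at s within I)"
    unfolding u_def
    by (intro bounded_bilinear.has_vector_derivative[OF bounded_bilinear_inner]
        has_vector_derivative_diff frame_derivatives' frame_facts s)
  \<comment> \<open>The first summand vanishes because the connecting vector is a multiple of
    \<open>T s\<close>; the second is \<open>0 - T s \<bullet> T s\<close>.\<close>
  then have "(u has_vector_derivative -1) (at s within I)"
    using orth inner_facts[OF s] by (simp add: \<phi>[OF s] inner_diff_left)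
  then have "((\<lambda>s. \<xi> s + u s *\<^sub>R T s) has_vector_derivative
      T s + (u s *\<^sub>R (\<kappa> *\<^sub>R N s) + (-1) *\<^sub>R T s)) (at s within I)"
    by (intro has_vector_derivative_add has_vector_derivative_scaleR frame_facts s)
      (simp add: has_real_derivative_iff_has_vector_derivative)
  from derivative_unique[OF s frame_derivatives'(1)[OF s] this \<phi>]
  have "speed s *\<^sub>R T\<^sub>\<phi> (\<sigma> s) = (u s * \<kappa>) *\<^sub>R N s"
    by simp
  \<comment> \<open>As \<open>u s * \<kappa>\<close> is positive, the speed cannot vanish and the
    tangent has the plus sign.\<close>
  from scaleR_unit_eqD[OF this] show "speed s > 0" "T\<^sub>\<phi> (\<sigma> s) = N s"
    using u_pos frame_facts(1)[OF s] inner_facts[OF s] frame_facts'[OF s] speed_nonneg[OF s]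
    by auto
qed

lemma w_pos: "s \<in> I \<Longrightarrow> w > 0" and w_square: "w * w = \<kappa> * \<kappa> + k * k"
  using frame_facts(1) by (auto simp: w_def add_pos_nonneg power2_eq_square)

definition X :: "real \<Rightarrow> quat" where "X s = (- \<kappa> / w) *\<^sub>R T s + (k / w) *\<^sub>R B s"

text \<open>A unit vector orthogonal to \<open>X\<close> in the plane of \<open>T\<close> and
  \<open>B\<close>.\<close>

definition Y :: "real \<Rightarrow> quat" where "Y s = (k / w) *\<^sub>R T s + (\<kappa> / w) *\<^sub>R B s"

text \<open>The lengths of \<open>X s\<close> and \<open>Y s\<close> reduce to
  \<open>w_square\<close>, and the two terms of \<open>X s \<bullet> Y s\<close> cancel. The order
  anticipates the frame of \<open>\<phi>\<close>.\<close>

lemma rotated_orthonormal: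
  assumes "s \<in> I"
  shows "q_orthonormal (N s) (X s) (E s) (Y s)"
proof -
  have "\<kappa> * \<kappa> / (w * w) + k * k / (w * w) = 1"
    using w_pos[OF assms] by (simp add: w_square[symmetric] add_divide_distrib[symmetric])
  then show ?thesis
    using inner_facts[OF assms]
    by (simp add: q_orthonormal_def qinner_eq_inner X_def Y_def inner_add_left inner_add_right
        inner_diff_left inner_diff_right add.commute mult.commute)
qed

text \<open>The derivative of the tangent \<open>N\<close> is \<open>w *\<^sub>R X s\<close>. Both
  coefficients compared are positive, so no sign is left open.\<close>

lemma normal:
  assumes s: "s \<in> I"
  shows "speed s * \<kappa>\<^sub>\<phi> (\<sigma> s) = w" "N\<^sub>\<phi> (\<sigma> s) = X s"
proof -
  have "(speed s * \<kappa>\<^sub>\<phi> (\<sigma> s)) *\<^sub>R N\<^sub>\<phi> (\<sigma> s) = - \<kappa> *\<^sub>R T s + k *\<^sub>R B s"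
    using derivative_unique[OF s frame_derivatives'(2)[OF s] frame_facts(6)[OF s]] tangent(2)
    by simp
  also have "\<dots> = w *\<^sub>R X s"
    using w_pos[OF s] by (simp add: X_def scaleR_diff_right)
  finally have eq: "(speed s * \<kappa>\<^sub>\<phi> (\<sigma> s)) *\<^sub>R N\<^sub>\<phi> (\<sigma> s) = w *\<^sub>R X s" .
  have "norm (X s) = 1"
    using rotated_orthonormal[OF s] by (simp add: q_orthonormal_def qinner_eq_inner norm_eq_1)
  then show "speed s * \<kappa>\<^sub>\<phi> (\<sigma> s) = w" "N\<^sub>\<phi> (\<sigma> s) = X s"
    using scaleR_unit_eqD[OF eq] tangent(1)[OF s] frame_facts'[OF s] w_pos[OF s] by auto
qed

lemma binormal:
  assumes s: "s \<in> I"
  shows "B\<^sub>\<phi> (\<sigma> s) \<bullet> E s \<in> {1, -1}" "B\<^sub>\<phi> (\<sigma> s) = (B\<^sub>\<phi> (\<sigma> s) \<bullet> E s) *\<^sub>R E s"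
proof -
  \<comment> \<open>Constant curvatures make the coefficients of \<open>X\<close> constant, so
    \<open>X\<close> changes only through \<open>T\<close> and \<open>B\<close>, whose derivatives
    lie in the plane of \<open>N\<close> and \<open>E\<close>.\<close>
  have "(X has_vector_derivative
      (- \<kappa> / w) *\<^sub>R (\<kappa> *\<^sub>R N s) + (k / w) *\<^sub>R (- k *\<^sub>R N s + m *\<^sub>R E s)) (at s within I)"
    unfolding X_def
    by (intro has_vector_derivative_add frame_facts s
        has_vector_derivative_scaleR[of "\<lambda>_. c" 0 for c, simplified])
  from derivative_unique[OF s frame_derivatives'(3)[OF s] this normal(2)]
  have "speed s *\<^sub>R (- \<kappa>\<^sub>\<phi> (\<sigma> s) *\<^sub>R N s + k\<^sub>\<phi> (\<sigma> s) *\<^sub>R B\<^sub>\<phi> (\<sigma> s)) =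
      (- \<kappa> / w) *\<^sub>R (\<kappa> *\<^sub>R N s) + (k / w) *\<^sub>R (- k *\<^sub>R N s + m *\<^sub>R E s)"
    by (simp add: tangent(2)[OF s])
  also have "\<dots> = (- ((\<kappa> * \<kappa> + k * k) / w)) *\<^sub>R N s + (k * m / w) *\<^sub>R E s"
    by (simp add: add_divide_distrib algebra_simps)
  \<comment> \<open>Hence the \<open>N s\<close> components of both sides agree and cancel.\<close>
  also have "(\<kappa> * \<kappa> + k * k) / w = speed s * \<kappa>\<^sub>\<phi> (\<sigma> s)"
    using w_pos[OF s] by (simp add: normal(1)[OF s] w_square[symmetric])
  finally have "(speed s * k\<^sub>\<phi> (\<sigma> s)) *\<^sub>R B\<^sub>\<phi> (\<sigma> s) = (k * m / w) *\<^sub>R E s"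
    by (simp add: scaleR_diff_right)
  \<comment> \<open>Nondegeneracy of \<open>\<phi>\<close> makes the left coefficient nonzero; the
    signs of \<open>k\<^sub>\<phi> (\<sigma> s)\<close>, \<open>k\<close> and \<open>m\<close> are
    unknown, so a sign stays open.\<close>
  from scaleR_unit_eq_signD[OF this]
  show "B\<^sub>\<phi> (\<sigma> s) \<bullet> E s \<in> {1, -1}" "B\<^sub>\<phi> (\<sigma> s) = (B\<^sub>\<phi> (\<sigma> s) \<bullet> E s) *\<^sub>R E s"
    using frame_facts'[OF s] inner_facts[OF s] tangent(1)[OF s] by auto
qed

text \<open>Both \<open>E\<^sub>\<phi> (\<sigma> s)\<close> and \<open>Y s\<close> complete the same
  three orthonormal vectors, since \<open>B\<^sub>\<phi> (\<sigma> s)\<close> differs from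
  \<open>E s\<close> only in sign.\<close>

lemma last_vector:
  assumes s: "s \<in> I"
  shows "E\<^sub>\<phi> (\<sigma> s) \<bullet> Y s \<in> {1, -1}" "E\<^sub>\<phi> (\<sigma> s) = (E\<^sub>\<phi> (\<sigma> s) \<bullet> Y s) *\<^sub>R Y s"
proof -
  have "q_orthonormal (N s) (X s) (B\<^sub>\<phi> (\<sigma> s)) (Y s)"
    using q_orthonormal_scaleR_sign[OF rotated_orthonormal[OF s] binormal(1)[OF s], of 1]
    by (simp add: binormal(2)[OF s, symmetric])
  moreover have "q_orthonormal (N s) (X s) (B\<^sub>\<phi> (\<sigma> s)) (E\<^sub>\<phi> (\<sigma> s))"
    using frame_facts'(3)[OF s] by (simp add: tangent(2)[OF s] normal(2)[OF s])
  ultimately show "E\<^sub>\<phi> (\<sigma> s) \<bullet> Y s \<in> {1, -1}" "E\<^sub>\<phi> (\<sigma> s) = (E\<^sub>\<phi> (\<sigma> s) \<bullet> Y s) *\<^sub>R Y s"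
    by (rule q_orthonormal_4th_unique)+
qed

text \<open>The signs are inner products of differentiable, hence continuous, curves. Two separate
  signs appear because no orientation of the frame of \<open>\<phi>\<close> is prescribed.\<close>

lemma constant_signs:
  obtains \<eta> \<delta> where "\<eta> \<in> {1, -1}" "\<delta> \<in> {1, -1}"
    "\<And>s. s \<in> I \<Longrightarrow> B\<^sub>\<phi> (\<sigma> s) = \<eta> *\<^sub>R E s" "\<And>s. s \<in> I \<Longrightarrow> E\<^sub>\<phi> (\<sigma> s) = \<delta> *\<^sub>R Y s"
proof -
  have cont: "continuous_on I f"
    if "\<And>s. s \<in> I \<Longrightarrow> (f has_vector_derivative D s) (at s within I)" for f :: "real \<Rightarrow> quat" and D
    using has_vector_derivative_continuous[OF that] by (auto simp: continuous_on_eq_continuous_within)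
  note cont_frame = cont[OF frame_facts(5)] cont[OF frame_facts(7)] cont[OF frame_facts(8)]
    cont[OF frame_derivatives'(4)] cont[OF frame_derivatives'(5)]
  have "continuous_on I (\<lambda>s. B\<^sub>\<phi> (\<sigma> s) \<bullet> E s)" "continuous_on I (\<lambda>s. E\<^sub>\<phi> (\<sigma> s) \<bullet> Y s)"
    unfolding Y_def by (intro continuous_intros cont_frame; assumption)+
  from sign_function_constant[OF interval(1) this(1) binormal(1)]
    sign_function_constant[OF interval(1) this(2) last_vector(1)]
  obtain \<eta> \<delta> where "\<eta> \<in> {1, -1}" "\<delta> \<in> {1, -1}"
    and *: "\<And>s. s \<in> I \<Longrightarrow> B\<^sub>\<phi> (\<sigma> s) \<bullet> E s = \<eta>" "\<And>s. s \<in> I \<Longrightarrow> E\<^sub>\<phi> (\<sigma> s) \<bullet> Y s = \<delta>"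
    by metis
  then show ?thesis
    using that[of \<eta> \<delta>] binormal(2) last_vector(2) by metis
qed

end

section \<open>The Serret-Frenet frames of the involute\<close>

theorem corollary3p5:
  fixes I J :: "real set" and \<xi> \<phi> :: "real \<Rightarrow> quat" and \<sigma> :: "real \<Rightarrow> real"
    and T\<^sub>\<xi> N\<^sub>\<xi> B\<^sub>\<xi> E\<^sub>\<xi> T\<^sub>\<phi> N\<^sub>\<phi> B\<^sub>\<phi> E\<^sub>\<phi> :: "real \<Rightarrow> quat"
    and \<kappa>\<^sub>\<xi> k r \<kappa>\<^sub>\<phi> k' r' :: "real \<Rightarrow> real"
  assumes "quaternionic_curve I \<xi>"
    and "serret_frenet I \<xi> T\<^sub>\<xi> N\<^sub>\<xi> B\<^sub>\<xi> E\<^sub>\<xi> \<kappa>\<^sub>\<xi> k r"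
    and "w_curve I \<kappa>\<^sub>\<xi> k r"
    and "quaternionic_curve J \<phi>"
    and "serret_frenet J \<phi> T\<^sub>\<phi> N\<^sub>\<phi> B\<^sub>\<phi> E\<^sub>\<phi> \<kappa>\<^sub>\<phi> k' r'"
    and "correspondence I J \<sigma>"
    and "involute I \<sigma> \<xi> T\<^sub>\<xi> \<phi> T\<^sub>\<phi>"
    and "involute_forward I \<sigma> \<xi> T\<^sub>\<xi> \<phi>"
  shows
    "\<comment> \<open>Every Serret-Frenet frame of \<open>\<phi>\<close> is, up to the sign \<open>\<epsilon>\<close> of its last vector, as displayed.\<close>
     (\<exists>\<eta>\<in>{1, -1}. \<exists>\<epsilon>\<in>{1, -1}. \<forall>s\<in>I.
        T\<^sub>\<phi> (\<sigma> s) = N\<^sub>\<xi> s \<and>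
        N\<^sub>\<phi> (\<sigma> s) = (- \<kappa>\<^sub>\<xi> s / sqrt ((\<kappa>\<^sub>\<xi> s)\<^sup>2 + (k s)\<^sup>2)) *\<^sub>R T\<^sub>\<xi> s
                  + (k s / sqrt ((\<kappa>\<^sub>\<xi> s)\<^sup>2 + (k s)\<^sup>2)) *\<^sub>R B\<^sub>\<xi> s \<and>
        B\<^sub>\<phi> (\<sigma> s) = \<eta> *\<^sub>R E\<^sub>\<xi> s \<and>
        \<epsilon> *\<^sub>R E\<^sub>\<phi> (\<sigma> s) = \<eta> *\<^sub>R ((k s / sqrt ((\<kappa>\<^sub>\<xi> s)\<^sup>2 + (k s)\<^sup>2)) *\<^sub>R T\<^sub>\<xi> s
                         + (\<kappa>\<^sub>\<xi> s / sqrt ((\<kappa>\<^sub>\<xi> s)\<^sup>2 + (k s)\<^sup>2)) *\<^sub>R B\<^sub>\<xi> s)) \<and>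
    \<comment> \<open>For both signs \<open>\<eta>\<close> the displayed vectors are a Serret-Frenet frame of \<open>\<phi>\<close>.\<close>
    (\<forall>\<eta>\<in>{1, -1}. \<exists>T N B E. serret_frenet_frame J \<phi> T N B E \<and> (\<forall>s\<in>I.
        T (\<sigma> s) = N\<^sub>\<xi> s \<and>
        N (\<sigma> s) = (- \<kappa>\<^sub>\<xi> s / sqrt ((\<kappa>\<^sub>\<xi> s)\<^sup>2 + (k s)\<^sup>2)) *\<^sub>R T\<^sub>\<xi> s
                + (k s / sqrt ((\<kappa>\<^sub>\<xi> s)\<^sup>2 + (k s)\<^sup>2)) *\<^sub>R B\<^sub>\<xi> s \<and>
        B (\<sigma> s) = \<eta> *\<^sub>R E\<^sub>\<xi> s \<and>
        E (\<sigma> s) = \<eta> *\<^sub>R ((k s / sqrt ((\<kappa>\<^sub>\<xi> s)\<^sup>2 + (k s)\<^sup>2)) *\<^sub>R T\<^sub>\<xi> s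
                       + (\<kappa>\<^sub>\<xi> s / sqrt ((\<kappa>\<^sub>\<xi> s)\<^sup>2 + (k s)\<^sup>2)) *\<^sub>R B\<^sub>\<xi> s)))"
proof -
  obtain \<kappa> l m where const_curvatures: "\<And>s. s \<in> I \<Longrightarrow> \<kappa>\<^sub>\<xi> s = \<kappa>" "\<And>s. s \<in> I \<Longrightarrow> k s = l"
    "\<And>s. s \<in> I \<Longrightarrow> r s - \<kappa>\<^sub>\<xi> s = m"
    using assms(3) unfolding w_curve_def constant_on_def by metis
  interpret involute_w_curve I J \<xi> \<phi> \<sigma> T\<^sub>\<xi> N\<^sub>\<xi> B\<^sub>\<xi> E\<^sub>\<xi> T\<^sub>\<phi> N\<^sub>\<phi> B\<^sub>\<phi> E\<^sub>\<phi> \<kappa>\<^sub>\<xi> k r \<kappa>\<^sub>\<phi> k' r' \<kappa> l m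
    using assms const_curvatures by unfold_locales (auto simp: quaternionic_curve_def)
  obtain \<eta>\<^sub>0 \<delta> where signs: "\<eta>\<^sub>0 \<in> {1, -1}" "\<delta> \<in> {1, -1}"
    and B: "\<And>s. s \<in> I \<Longrightarrow> B\<^sub>\<phi> (\<sigma> s) = \<eta>\<^sub>0 *\<^sub>R E\<^sub>\<xi> s"
    and E: "\<And>s. s \<in> I \<Longrightarrow> E\<^sub>\<phi> (\<sigma> s) = \<delta> *\<^sub>R Y s"
    using constant_signs by blast
  have X_eq: "(- \<kappa>\<^sub>\<xi> s / sqrt ((\<kappa>\<^sub>\<xi> s)\<^sup>2 + (k s)\<^sup>2)) *\<^sub>R T\<^sub>\<xi> s
      + (k s / sqrt ((\<kappa>\<^sub>\<xi> s)\<^sup>2 + (k s)\<^sup>2)) *\<^sub>R B\<^sub>\<xi> s = X s"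
    and Y_eq: "(k s / sqrt ((\<kappa>\<^sub>\<xi> s)\<^sup>2 + (k s)\<^sup>2)) *\<^sub>R T\<^sub>\<xi> s
      + (\<kappa>\<^sub>\<xi> s / sqrt ((\<kappa>\<^sub>\<xi> s)\<^sup>2 + (k s)\<^sup>2)) *\<^sub>R B\<^sub>\<xi> s = Y s" if "s \<in> I" for s
    using const_curvatures[OF that] by (simp_all add: X_def Y_def w_def)
  show ?thesis
  proof (intro conjI ballI)
    \<comment> \<open>The witness for \<open>\<epsilon>\<close> is
      \<open>\<eta>\<^sub>0 * \<delta>\<close>: it removes the sign \<open>\<delta>\<close> of
      \<open>E\<^sub>\<phi>\<close> and puts \<open>\<eta>\<^sub>0\<close> in its place.\<close>
    have "\<eta>\<^sub>0 * \<delta> \<in> {1, -1}" "\<eta>\<^sub>0 * \<delta> * \<delta> = \<eta>\<^sub>0"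
      using signs by auto
    with signs(1) show "\<exists>\<eta>\<in>{1, -1}. \<exists>\<epsilon>\<in>{1, -1}. \<forall>s\<in>I.
        T\<^sub>\<phi> (\<sigma> s) = N\<^sub>\<xi> s \<and>
        N\<^sub>\<phi> (\<sigma> s) = (- \<kappa>\<^sub>\<xi> s / sqrt ((\<kappa>\<^sub>\<xi> s)\<^sup>2 + (k s)\<^sup>2)) *\<^sub>R T\<^sub>\<xi> s
                  + (k s / sqrt ((\<kappa>\<^sub>\<xi> s)\<^sup>2 + (k s)\<^sup>2)) *\<^sub>R B\<^sub>\<xi> s \<and>
        B\<^sub>\<phi> (\<sigma> s) = \<eta> *\<^sub>R E\<^sub>\<xi> s \<and>
        \<epsilon> *\<^sub>R E\<^sub>\<phi> (\<sigma> s) = \<eta> *\<^sub>R ((k s / sqrt ((\<kappa>\<^sub>\<xi> s)\<^sup>2 + (k s)\<^sup>2)) *\<^sub>R T\<^sub>\<xi> s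
                         + (\<kappa>\<^sub>\<xi> s / sqrt ((\<kappa>\<^sub>\<xi> s)\<^sup>2 + (k s)\<^sup>2)) *\<^sub>R B\<^sub>\<xi> s)"
      by (intro bexI[of _ \<eta>\<^sub>0] bexI[of _ "\<eta>\<^sub>0 * \<delta>"] ballI)
        (simp_all only: X_eq Y_eq tangent(2) normal(2) B E scaleR_scaleR simp_thms)
  next
    fix \<eta> :: real assume \<eta>: "\<eta> \<in> {1, -1}"
    \<comment> \<open>These factors replace the sign \<open>\<eta>\<^sub>0\<close> of
      \<open>B\<^sub>\<phi>\<close> and the sign \<open>\<delta>\<close> of
      \<open>E\<^sub>\<phi>\<close> by the given \<open>\<eta>\<close>.\<close>
    have s: "\<eta> * \<eta>\<^sub>0 \<in> {1, -1}" "\<eta> * \<delta> \<in> {1, -1}" "\<eta> * \<eta>\<^sub>0 * \<eta>\<^sub>0 = \<eta>" "\<eta> * \<delta> * \<delta> = \<eta>"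
      using signs \<eta> by auto
    have "serret_frenet_frame J \<phi> T\<^sub>\<phi> N\<^sub>\<phi> (\<lambda>t. (\<eta> * \<eta>\<^sub>0) *\<^sub>R B\<^sub>\<phi> t) (\<lambda>t. (\<eta> * \<delta>) *\<^sub>R E\<^sub>\<phi> t)"
      using serret_frenet_scaleR_sign[OF assms(5) s(1,2)] unfolding serret_frenet_frame_def by blast
    moreover have "\<forall>s\<in>I. T\<^sub>\<phi> (\<sigma> s) = N\<^sub>\<xi> s \<and> N\<^sub>\<phi> (\<sigma> s) = X s \<and>
        (\<eta> * \<eta>\<^sub>0) *\<^sub>R B\<^sub>\<phi> (\<sigma> s) = \<eta> *\<^sub>R E\<^sub>\<xi> s \<and> (\<eta> * \<delta>) *\<^sub>R E\<^sub>\<phi> (\<sigma> s) = \<eta> *\<^sub>R Y s"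
      using s by (simp add: tangent(2) normal(2) B E)
    ultimately show "\<exists>T N B E. serret_frenet_frame J \<phi> T N B E \<and> (\<forall>s\<in>I.
        T (\<sigma> s) = N\<^sub>\<xi> s \<and>
        N (\<sigma> s) = (- \<kappa>\<^sub>\<xi> s / sqrt ((\<kappa>\<^sub>\<xi> s)\<^sup>2 + (k s)\<^sup>2)) *\<^sub>R T\<^sub>\<xi> s
                + (k s / sqrt ((\<kappa>\<^sub>\<xi> s)\<^sup>2 + (k s)\<^sup>2)) *\<^sub>R B\<^sub>\<xi> s \<and>
        B (\<sigma> s) = \<eta> *\<^sub>R E\<^sub>\<xi> s \<and>
        E (\<sigma> s) = \<eta> *\<^sub>R ((k s / sqrt ((\<kappa>\<^sub>\<xi> s)\<^sup>2 + (k s)\<^sup>2)) *\<^sub>R T\<^sub>\<xi> s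
                       + (\<kappa>\<^sub>\<xi> s / sqrt ((\<kappa>\<^sub>\<xi> s)\<^sup>2 + (k s)\<^sup>2)) *\<^sub>R B\<^sub>\<xi> s))"
      using X_eq Y_eq
      by (intro exI[of _ T\<^sub>\<phi>] exI[of _ N\<^sub>\<phi>] exI[of _ "\<lambda>t. (\<eta> * \<eta>\<^sub>0) *\<^sub>R B\<^sub>\<phi> t"]
          exI[of _ "\<lambda>t. (\<eta> * \<delta>) *\<^sub>R E\<^sub>\<phi> t"] conjI ballI) auto
  qed
qed

end
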